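(* For any $\alpha\in(0,1)$ there exists a constant $C_\alpha>0$ such that the inequality $$E\bigl|X_n^{(\alpha)}(t)-X_n^{(\alpha)}(s)\bigr|^{4}\le C_\alpha\,|s-t|^2$$ holds for all $s,t>0$ and all $n\in\mathbb{N}$, where $X_n^{(\alpha)}$ denotes the rescaled linear interpolation of the $\alpha$-skew random walk on $\mathbb{Z}$.
   Context: Let $\mathbb{N}=\{1,2,\dots\}$. For $\alpha\in(0,1)$, the $\alpha$-skew random walk on $\mathbb{Z}$ starting at $0$ is the (time-homogeneous) birth-death Markov chain $S^{(\alpha)}=\{S_k^{(\alpha)}: k\ge 0\}$ on $\mathbb{Z}$ with $S_0^{(\alpha)}=0$ and one-step transition probabilities $$P\bigl(S_{k+1}^{(\alpha)}=m+1\mid S_k^{(\alpha)}=m\bigr)=\begin{cases}\alpha & \text{if } m=0\\ \tfrac12 & \text{otherwise,}\end{cases}\qquad P\bigl(S_{k+1}^{(\alpha)}=m-1\mid S_k^{(\alpha)}=m\bigr)=\begin{cases}1-\alpha & \text{if } m=0\\ \tfrac12 & \text{otherwise.}\end{cases}$$ For $n\in\mathbb{N}$ and $t\ge 0$, with $[x]$ denoting the integer part of a real number $x$, $$X_n^{(\alpha)}(t)=\frac{1}{\sqrt n}\Bigl(S^{(\alpha)}_{[nt]}+(nt-[nt])\bigl(S^{(\alpha)}_{[nt]+1}-S^{(\alpha)}_{[nt]}\bigr)\Bigr).$$ *)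

theory Defs
  imports "HOL-Probability.Probability"
begin

text \<open>
  Time-homogeneous Markov chain on a discrete state space with initial state \<open>x0\<close> and one-step
  transition probabilities \<open>p x y\<close> (from \<open>x\<close> to \<open>y\<close>). The conditioning is on the whole past; it is
  required only for pasts of positive probability, since \<^const>\<open>cond_prob\<close> is \<open>0\<close> by convention when
  the conditioning event is null.
\<close>

definition markov_chain ::
  "('s \<Rightarrow> 's \<Rightarrow> real) \<Rightarrow> 's \<Rightarrow> 'a measure \<Rightarrow> (nat \<Rightarrow> 'a \<Rightarrow> 's) \<Rightarrow> bool" where
  "markov_chain p x0 M S \<longleftrightarrow>
     prob_space M \<and>
     (\<forall>k. S k \<in> measurable M (count_space UNIV)) \<and>
     (AE \<omega> in M. S 0 \<omega> = x0) \<and>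
     (\<forall>k x y. \<P>(\<omega> in M. \<forall>i\<le>k. S i \<omega> = x i) > 0 \<longrightarrow>
        \<P>(\<omega> in M. S (Suc k) \<omega> = y \<bar> \<forall>i\<le>k. S i \<omega> = x i) = p (x k) y)"

definition skew_transition :: "real \<Rightarrow> int \<Rightarrow> int \<Rightarrow> real" where
  "skew_transition \<alpha> m j =
     (if j = m + 1 then (if m = 0 then \<alpha> else 1 / 2)
      else if j = m - 1 then (if m = 0 then 1 - \<alpha> else 1 / 2)
      else 0)"

definition skew_random_walk :: "real \<Rightarrow> 'a measure \<Rightarrow> (nat \<Rightarrow> 'a \<Rightarrow> int) \<Rightarrow> bool" where
  "skew_random_walk \<alpha> M S \<longleftrightarrow> markov_chain (skew_transition \<alpha>) 0 M S"

text \<open>The rescaled linear interpolation; it is only meant for \<open>n \<ge> 1\<close> and \<open>t \<ge> 0\<close>.\<close>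

definition rescaled_walk :: "(nat \<Rightarrow> 'a \<Rightarrow> int) \<Rightarrow> nat \<Rightarrow> real \<Rightarrow> 'a \<Rightarrow> real" where
  "rescaled_walk S n t \<omega> =
     (let k = nat \<lfloor>real n * t\<rfloor> in
        1 / sqrt (real n) *
          (real_of_int (S k \<omega>) +
           (real n * t - real k) * (real_of_int (S (k + 1) \<omega>) - real_of_int (S k \<omega>))))"

end

theory Submission
  imports Defs
begin

text \<open>
  Unless \<open>\<alpha> = 1/2\<close>, the skew walk \<open>S\<close> has a drift at \<open>0\<close>. It becomes a martingale once
  the two half-lines are rescaled: the function \<open>h\<close> (below: \<open>skew_scale\<close>) with slope \<open>1 - \<alpha>\<close> on the
  positive and slope \<open>\<alpha>\<close> on the negative side satisfies \<open>\<alpha> h(1) + (1 - \<alpha>) h(-1) = 0\<close>, hence is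
  harmonic for the transition probabilities. The image \<open>h(S)\<close> is a martingale with steps of size at
  most \<open>1\<close>, and \<open>h\<close> is expanding up to the factor \<open>c = min \<alpha> (1 - \<alpha>)\<close>, so fourth moments of
  increments of \<open>S\<close> are at most \<open>c\<^sup>-\<^sup>4\<close> times those of \<open>h(S)\<close>.

  For a martingale \<open>Y\<close> with \<open>Y 0 = 0\<close> and steps bounded by \<open>1\<close>, expanding \<open>(Y + D)\<^sup>4\<close> in the next
  step \<open>D\<close> kills the term \<open>4 Y\<^sup>3 D\<close> in expectation and leaves a growth of order \<open>E Y\<^sup>2\<close>, which is at
  most linear in time. Hence \<open>E (Y m)\<^sup>4 \<le> 4 m\<^sup>2\<close> (\<open>fourth_moment_bounded_increments\<close>). Applied to
  \<open>Y m = h(S (k + m)) - h(S k)\<close>, this gives \<open>E (S (k + m) - S k)\<^sup>4 \<le> 4 c\<^sup>-\<^sup>4 m\<^sup>2\<close> for all \<open>k\<close> and \<open>m\<close>.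

  In the unscaled time \<open>a = n s\<close>, \<open>b = n t\<close> the claim becomes a bound by a multiple of \<open>(b - a)\<^sup>2\<close>,
  since the space factor \<open>1 / sqrt n\<close> contributes exactly \<open>1 / n\<^sup>2\<close>. If \<open>b - a > 1\<close>, replacing
  \<open>a\<close> and \<open>b\<close> by their integer parts costs a bounded amount, dominated by \<open>(b - a)\<^sup>2\<close>. If
  \<open>b - a \<le> 1\<close>, that error would be too large, but the interpolated path is \<open>1\<close>-Lipschitz over such a
  gap and \<open>(b - a)\<^sup>4 \<le> (b - a)\<^sup>2\<close>.
\<close>

section \<open>Cylinder probabilities of a Markov chain\<close>

text \<open>
  The product form also covers pasts of probability \<open>0\<close>, where both sides vanish, so that sums
  over all pasts need no case distinction.
\<close>

lemma markov_chain_cylinder_prob: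
  fixes M :: "'a measure" and S :: "nat \<Rightarrow> 'a \<Rightarrow> 's"
  assumes mc: "markov_chain p x0 M S"
  shows "\<P>(\<omega> in M. S (Suc k) \<omega> = y \<and> (\<forall>i\<le>k. S i \<omega> = x i))
       = p (x k) y * \<P>(\<omega> in M. \<forall>i\<le>k. S i \<omega> = x i)"
proof -
  interpret prob_space M using mc by (simp add: markov_chain_def)
  have [measurable]: "\<And>k. S k \<in> measurable M (count_space UNIV)"
    using mc by (simp add: markov_chain_def)
  let ?Q = "\<P>(\<omega> in M. \<forall>i\<le>k. S i \<omega> = x i)"
  show ?thesis
  proof (cases "?Q > 0")
    case True
    then have "\<P>(\<omega> in M. S (Suc k) \<omega> = y \<bar> \<forall>i\<le>k. S i \<omega> = x i) = p (x k) y"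
      using mc by (simp add: markov_chain_def)
    with True show ?thesis by (simp add: cond_prob_def field_simps)
  next
    case False
    then have Q: "?Q = 0" by (meson measure_nonneg order_antisym_conv not_less)
    have "\<P>(\<omega> in M. S (Suc k) \<omega> = y \<and> (\<forall>i\<le>k. S i \<omega> = x i)) \<le> ?Q"
      by (rule finite_measure_mono) auto
    with Q show ?thesis by (simp add: measure_le_0_iff)
  qed
qed

section \<open>Paths of the skew random walk\<close>

lemma skew_random_walk_markov_chain:
  "skew_random_walk \<alpha> M S \<Longrightarrow> markov_chain (skew_transition \<alpha>) 0 M S"
  by (simp add: skew_random_walk_def)

lemma skew_random_walk_prob_space: "skew_random_walk \<alpha> M S \<Longrightarrow> prob_space M"
  by (simp add: skew_random_walk_def markov_chain_def)

lemma skew_random_walk_measurable: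
  "skew_random_walk \<alpha> M S \<Longrightarrow> S k \<in> measurable M (count_space UNIV)"
  by (simp add: skew_random_walk_def markov_chain_def)

text \<open>
  On each cylinder the two neighbours of the current state carry the whole mass. A past up to
  time \<open>k\<close> ranges over the countable set \<^term>\<open>PiE {..k} (\<lambda>_. UNIV :: int set)\<close>, so the exceptional null sets
  of the individual cylinders can be united.
\<close>

lemma skew_random_walk_unit_steps:
  fixes M :: "'a measure" and S :: "nat \<Rightarrow> 'a \<Rightarrow> int"
  assumes S: "skew_random_walk \<alpha> M S"
  shows "AE \<omega> in M. S (Suc k) \<omega> = S k \<omega> + 1 \<or> S (Suc k) \<omega> = S k \<omega> - 1"
proof -
  interpret prob_space M by (rule skew_random_walk_prob_space[OF S])
  note [measurable] = skew_random_walk_measurable[OF S]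
  have cyl: "AE \<omega> in M. (\<forall>i\<le>k. S i \<omega> = x i) \<longrightarrow>
      S (Suc k) \<omega> = x k + 1 \<or> S (Suc k) \<omega> = x k - 1" for x
  proof -
    let ?Q = "{\<omega> \<in> space M. \<forall>i\<le>k. S i \<omega> = x i}"
    let ?U = "{\<omega> \<in> space M. S (Suc k) \<omega> = x k + 1 \<and> (\<forall>i\<le>k. S i \<omega> = x i)}"
    let ?D = "{\<omega> \<in> space M. S (Suc k) \<omega> = x k - 1 \<and> (\<forall>i\<le>k. S i \<omega> = x i)}"
    have "prob (?U \<union> ?D) = prob ?U + prob ?D"
      by (rule finite_measure_Union) auto
    also have "\<dots> = prob ?Q"
      using markov_chain_cylinder_prob[OF skew_random_walk_markov_chain[OF S], of k "x k + 1" x]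
        markov_chain_cylinder_prob[OF skew_random_walk_markov_chain[OF S], of k "x k - 1" x]
      by (auto simp: skew_transition_def algebra_simps)
    finally have "prob (?Q - (?U \<union> ?D)) = 0"
      by (subst finite_measure_Diff) auto
    then have "AE \<omega> in M. \<omega> \<notin> ?Q - (?U \<union> ?D)"
      by (intro AE_not_in) (auto simp: null_sets_def emeasure_eq_measure)
    then show ?thesis by (auto elim!: AE_mp)
  qed
  have "AE \<omega> in M. \<forall>x\<in>PiE {..k} (\<lambda>_. UNIV). (\<forall>i\<le>k. S i \<omega> = x i) \<longrightarrow>
      S (Suc k) \<omega> = x k + 1 \<or> S (Suc k) \<omega> = x k - 1"
    using cyl by (subst AE_ball_countable) (auto intro!: countable_PiE)
  then show ?thesis
  proof eventually_elim
    case (elim \<omega>)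
    from bspec[OF this, of "\<lambda>i\<in>{..k}. S i \<omega>"] show ?case by auto
  qed
qed

lemma skew_random_walk_abs_le:
  fixes M :: "'a measure" and S :: "nat \<Rightarrow> 'a \<Rightarrow> int"
  assumes S: "skew_random_walk \<alpha> M S"
  shows "AE \<omega> in M. \<bar>S k \<omega>\<bar> \<le> int k"
proof (induction k)
  case 0
  then show ?case using S by (auto simp: skew_random_walk_def markov_chain_def elim!: AE_mp)
next
  case (Suc k)
  with skew_random_walk_unit_steps[OF S, of k] show ?case
    by eventually_elim auto
qed

section \<open>The scale function and its martingale\<close>

text \<open>
  A scale function of the birth-death chain: the slope on either side of \<open>0\<close> is the probability of
  stepping from \<open>0\<close> to the other side.
\<close>

definition skew_scale :: "real \<Rightarrow> int \<Rightarrow> real" where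
  "skew_scale \<alpha> m = (if 0 \<le> m then 1 - \<alpha> else \<alpha>) * real_of_int m"

lemma skew_scale_harmonic:
  "skew_transition \<alpha> m (m + 1) * (skew_scale \<alpha> (m + 1) - skew_scale \<alpha> m)
   + skew_transition \<alpha> m (m - 1) * (skew_scale \<alpha> (m - 1) - skew_scale \<alpha> m) = 0"
proof -
  consider "m = 0" | "m \<ge> 1" | "m \<le> -1" by linarith
  then show ?thesis
  proof cases
    case 3
    then show ?thesis by (cases "m = -1") (auto simp: skew_transition_def skew_scale_def field_simps)
  qed (auto simp: skew_transition_def skew_scale_def field_simps)
qed

text \<open>
  Subtracting the line \<open>c x\<close> with \<open>c\<close> the smaller of the two slopes leaves a nondecreasing function.
\<close>

lemma skew_scale_expanding:
  "min \<alpha> (1 - \<alpha>) * \<bar>real_of_int (x - y)\<bar> \<le> \<bar>skew_scale \<alpha> x - skew_scale \<alpha> y\<bar>"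
proof -
  define c where "c = min \<alpha> (1 - \<alpha>)"
  have *: "c * real_of_int (x - y) \<le> skew_scale \<alpha> x - skew_scale \<alpha> y" if "y \<le> x" for x y
  proof -
    have "mono (\<lambda>m. (if (0::int) \<le> m then 1 - \<alpha> - c else \<alpha> - c) * real_of_int m)"
      by (rule monoI) (auto simp: c_def intro: mult_left_mono
          order_trans[OF mult_nonneg_nonpos mult_nonneg_nonneg])
    from monoD[OF this that] show ?thesis
      by (auto simp: skew_scale_def algebra_simps split: if_splits)
  qed
  show ?thesis
  proof (cases "y \<le> x")
    case True
    with *[OF True] show ?thesis unfolding c_def[symmetric] by auto
  next
    case False
    then have "x \<le> y" by simp
    from *[OF this] \<open>x \<le> y\<close> show ?thesis unfolding c_def[symmetric] by auto
  qed
qed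

lemma skew_scale_unit_step:
  assumes "0 < \<alpha>" "\<alpha> < 1" and "y = x + 1 \<or> y = x - 1"
  shows "\<bar>skew_scale \<alpha> y - skew_scale \<alpha> x\<bar> \<le> 1"
proof -
  consider "x = 0" | "x = -1" | "x \<ge> 1" | "x \<le> -2" by linarith
  then show ?thesis
    using assms by cases (auto simp: skew_scale_def algebra_simps abs_if)
qed

text \<open>
  The martingale property of the scaled walk, as orthogonality of the next step to the past. Since
  \<open>\<bar>S i\<bar> \<le> i\<close> almost surely, only finitely many pasts up to time \<open>k\<close> occur; the expectation is a
  finite sum over them, and harmonicity makes each summand vanish. This is why \<open>G\<close> may be arbitrary.
\<close>

lemma skew_scale_martingale:
  fixes M :: "'a measure" and S :: "nat \<Rightarrow> 'a \<Rightarrow> int"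
    and G :: "(nat \<Rightarrow> int) \<Rightarrow> real"
  assumes S: "skew_random_walk \<alpha> M S"
  shows "prob_space.expectation M
    (\<lambda>\<omega>. G (\<lambda>i\<in>{..k}. S i \<omega>) * (skew_scale \<alpha> (S (Suc k) \<omega>) - skew_scale \<alpha> (S k \<omega>))) = 0"
proof -
  interpret prob_space M by (rule skew_random_walk_prob_space[OF S])
  note [measurable] = skew_random_walk_measurable[OF S]
  let ?h = "skew_scale \<alpha>"
  \<comment> \<open>The past takes countably many values, so every function of it is measurable.\<close>
  have pasts: "countable (PiE {..k} (\<lambda>_. UNIV :: int set))" by (intro countable_PiE) auto
  have "(\<lambda>\<omega>. \<lambda>i\<in>{..k}. S i \<omega>) \<in> measurable M (count_space (PiE {..k} (\<lambda>_. UNIV)))"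
    unfolding measurable_count_space_eq_countable[OF pasts]
  proof (intro conjI ballI)
    fix x :: "nat \<Rightarrow> int" assume x: "x \<in> PiE {..k} (\<lambda>_. UNIV)"
    have "(\<lambda>i\<in>{..k}. S i \<omega>) = x \<longleftrightarrow> (\<forall>i\<le>k. S i \<omega> = x i)" for \<omega>
    proof
      assume "\<forall>i\<le>k. S i \<omega> = x i"
      then show "(\<lambda>i\<in>{..k}. S i \<omega>) = x" by (intro PiE_ext[OF _ x]) auto
    qed auto
    then have "(\<lambda>\<omega>. \<lambda>i\<in>{..k}. S i \<omega>) -` {x} \<inter> space M = {\<omega> \<in> space M. \<forall>i\<le>k. S i \<omega> = x i}"
      by blast
    moreover have "{\<omega> \<in> space M. \<forall>i\<le>k. S i \<omega> = x i} \<in> sets M" by measurable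
    ultimately show "(\<lambda>\<omega>. \<lambda>i\<in>{..k}. S i \<omega>) -` {x} \<inter> space M \<in> sets M" by simp
  qed (simp add: restrict_PiE_iff)
  then have past_fun: "(\<lambda>\<omega>. G (\<lambda>i\<in>{..k}. S i \<omega>)) \<in> borel_measurable M"
    by (rule measurable_compose[where g = G]) (rule borel_measurable_count_space)
  define F :: "(nat \<Rightarrow> int) set" where "F = PiE {..k} (\<lambda>i. {- int k..int k})"
  have fin: "finite F" by (auto simp: F_def intro!: finite_PiE)
  \<comment> \<open>\<open>T x\<close> is the part of the integrand on the past \<open>x\<close>, split by the direction of the next step.\<close>
  define J where "J x y = (indicator {\<omega> \<in> space M. S (Suc k) \<omega> = y \<and> (\<forall>i\<le>k. S i \<omega> = x i)} :: 'a \<Rightarrow> real)"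
    for x y
  have J: "integrable M (J x y)"
    "expectation (J x y) = skew_transition \<alpha> (x k) y * \<P>(\<omega> in M. \<forall>i\<le>k. S i \<omega> = x i)" for x y
    using markov_chain_cylinder_prob[OF skew_random_walk_markov_chain[OF S], of k y x]
    by (auto simp: J_def emeasure_eq_measure Int_def conj_commute)
  define T where "T x \<omega> = G x * ((?h (x k + 1) - ?h (x k)) * J x (x k + 1) \<omega>
      + (?h (x k - 1) - ?h (x k)) * J x (x k - 1) \<omega>)" for x \<omega>
  have T: "integrable M (T x)" "expectation (T x) = 0" for x
  proof -
    show "integrable M (T x)" unfolding T_def using J(1) by auto
    have "expectation (T x) = G x * ((?h (x k + 1) - ?h (x k)) * expectation (J x (x k + 1))
      + (?h (x k - 1) - ?h (x k)) * expectation (J x (x k - 1)))"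
      unfolding T_def using J(1) by simp
    also have "\<dots> = G x * \<P>(\<omega> in M. \<forall>i\<le>k. S i \<omega> = x i) *
      (skew_transition \<alpha> (x k) (x k + 1) * (?h (x k + 1) - ?h (x k))
       + skew_transition \<alpha> (x k) (x k - 1) * (?h (x k - 1) - ?h (x k)))"
      unfolding J(2) by (simp add: algebra_simps)
    finally show "expectation (T x) = 0" by (simp add: skew_scale_harmonic)
  qed
  have "AE \<omega> in M. \<forall>i\<in>{..k}. \<bar>S i \<omega>\<bar> \<le> int i"
    using skew_random_walk_abs_le[OF S] by (subst AE_ball_countable) auto
  with skew_random_walk_unit_steps[OF S, of k] AE_space
  have sum_over_pasts:
    "AE \<omega> in M. G (\<lambda>i\<in>{..k}. S i \<omega>) * (?h (S (Suc k) \<omega>) - ?h (S k \<omega>)) = (\<Sum>x\<in>F. T x \<omega>)"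
  proof eventually_elim
    case (elim \<omega>)
    let ?x = "\<lambda>i\<in>{..k}. S i \<omega>"
    have "- int k \<le> S i \<omega> \<and> S i \<omega> \<le> int k" if "i \<le> k" for i
      using bspec[OF elim(3), of i] that by auto
    then have "?x \<in> F" by (simp add: F_def restrict_PiE_iff)
    moreover have "T x \<omega> = 0" if "x \<in> F - {?x}" for x
    proof -
      have "\<exists>i\<le>k. x i \<noteq> ?x i"
        using that by (metis (no_types, lifting) DiffE F_def PiE_ext \<open>?x \<in> F\<close> atMost_iff singletonI)
      then have "J x y \<omega> = 0" for y unfolding J_def indicator_eq_0_iff by auto
      then show ?thesis by (simp add: T_def)
    qed
    ultimately have "(\<Sum>x\<in>F. T x \<omega>) = T ?x \<omega>"
      using fin by (simp add: sum.remove[of F ?x])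
    also have "\<dots> = G ?x * (?h (S (Suc k) \<omega>) - ?h (S k \<omega>))"
      using elim by (auto simp: T_def J_def)
    finally show ?case by simp
  qed
  have step: "(\<lambda>\<omega>. ?h (S (Suc k) \<omega>) - ?h (S k \<omega>)) \<in> borel_measurable M" by measurable
  have "expectation (\<lambda>\<omega>. G (\<lambda>i\<in>{..k}. S i \<omega>) * (?h (S (Suc k) \<omega>) - ?h (S k \<omega>)))
      = expectation (\<lambda>\<omega>. \<Sum>x\<in>F. T x \<omega>)"
  proof (rule integral_cong_AE)
    show "(\<lambda>\<omega>. G (\<lambda>i\<in>{..k}. S i \<omega>) * (?h (S (Suc k) \<omega>) - ?h (S k \<omega>))) \<in> borel_measurable M"
      by (rule borel_measurable_times[OF past_fun step])
    show "(\<lambda>\<omega>. \<Sum>x\<in>F. T x \<omega>) \<in> borel_measurable M"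
      by (rule borel_measurable_sum) (rule borel_measurable_integrable[OF T(1)])
  qed (rule sum_over_pasts)
  also have "\<dots> = 0" using T by simp
  finally show ?thesis .
qed

section \<open>Fourth moments of martingales with bounded increments\<close>

text \<open>
  The martingale property enters only through the orthogonality of the increments to \<open>Y m\<close> and
  \<open>(Y m)\<^sup>3\<close>. The first gives \<open>E (Y m)\<^sup>2 \<le> m\<close>; the second then gives a growth of \<open>E (Y m)\<^sup>4\<close> by at most
  \<open>8 m + 3 \<le> 4 (m + 1)\<^sup>2 - 4 m\<^sup>2\<close> in one step.
\<close>

lemma (in prob_space) fourth_moment_bounded_increments:
  fixes Y :: "nat \<Rightarrow> 'a \<Rightarrow> real"
  assumes [measurable]: "\<And>m. Y m \<in> borel_measurable M"
    and Y0: "\<And>\<omega>. Y 0 \<omega> = 0"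
    and inc: "\<And>m. AE \<omega> in M. \<bar>Y (Suc m) \<omega> - Y m \<omega>\<bar> \<le> 1"
    and orth1: "\<And>m. expectation (\<lambda>\<omega>. Y m \<omega> * (Y (Suc m) \<omega> - Y m \<omega>)) = 0"
    and orth3: "\<And>m. expectation (\<lambda>\<omega>. Y m \<omega> ^ 3 * (Y (Suc m) \<omega> - Y m \<omega>)) = 0"
  shows "integrable M (\<lambda>\<omega>. Y m \<omega> ^ 4)"
    and "expectation (\<lambda>\<omega>. Y m \<omega> ^ 4) \<le> 4 * (real m)\<^sup>2"
proof -
  have bd: "AE \<omega> in M. \<bar>Y m \<omega>\<bar> \<le> real m" for m
  proof (induction m)
    case (Suc m)
    with inc[of m] show ?case by eventually_elim auto
  qed (simp add: Y0)
  have int_pow: "integrable M (\<lambda>\<omega>. Y m \<omega> ^ j)" for m j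
    using bd[of m] by (intro integrable_const_bound[where B="real m ^ j"])
      (auto elim!: eventually_mono simp: power_abs intro!: power_mono)
  have int_inc: "integrable M (\<lambda>\<omega>. Y m \<omega> ^ j * (Y (Suc m) \<omega> - Y m \<omega>))" for m j
    using bd[of m] inc[of m]
  proof (intro integrable_const_bound[where B="real m ^ j"], eventually_elim)
    case (elim \<omega>)
    then have "\<bar>Y m \<omega>\<bar> ^ j * \<bar>Y (Suc m) \<omega> - Y m \<omega>\<bar> \<le> real m ^ j * 1"
      by (intro mult_mono power_mono) auto
    then show ?case by (simp add: abs_mult power_abs)
  qed auto
  have second: "expectation (\<lambda>\<omega>. Y m \<omega> ^ 2) \<le> real m" for m
  proof (induction m)
    case (Suc m)
    have "expectation (\<lambda>\<omega>. Y (Suc m) \<omega> ^ 2)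
        \<le> expectation (\<lambda>\<omega>. Y m \<omega> ^ 2 + 2 * (Y m \<omega> ^ 1 * (Y (Suc m) \<omega> - Y m \<omega>)) + 1)"
    proof (intro integral_mono_AE)
      show "AE \<omega> in M. Y (Suc m) \<omega> ^ 2 \<le> Y m \<omega> ^ 2 + 2 * (Y m \<omega> ^ 1 * (Y (Suc m) \<omega> - Y m \<omega>)) + 1"
        using inc[of m]
      proof eventually_elim
        case (elim \<omega>)
        then have "(Y (Suc m) \<omega> - Y m \<omega>)\<^sup>2 \<le> 1" by (simp add: abs_square_le_1)
        then show ?case by (simp add: power2_eq_square algebra_simps)
      qed
    qed (intro Bochner_Integration.integrable_add integrable_mult_right int_pow int_inc integrable_const)+
    also have "\<dots> = expectation (\<lambda>\<omega>. Y m \<omega> ^ 2) + 1"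
      using int_pow int_inc[of m 1] orth1[of m] by (simp add: prob_space)
    finally show ?case using Suc by simp
  qed (simp add: Y0)
  show "integrable M (\<lambda>\<omega>. Y m \<omega> ^ 4)" by (rule int_pow)
  show "expectation (\<lambda>\<omega>. Y m \<omega> ^ 4) \<le> 4 * (real m)\<^sup>2"
  proof (induction m)
    case (Suc m)
    have "expectation (\<lambda>\<omega>. Y (Suc m) \<omega> ^ 4)
        \<le> expectation (\<lambda>\<omega>. Y m \<omega> ^ 4 + 4 * (Y m \<omega> ^ 3 * (Y (Suc m) \<omega> - Y m \<omega>)) + 8 * Y m \<omega> ^ 2 + 3)"
    proof (intro integral_mono_AE)
      show "AE \<omega> in M. Y (Suc m) \<omega> ^ 4
          \<le> Y m \<omega> ^ 4 + 4 * (Y m \<omega> ^ 3 * (Y (Suc m) \<omega> - Y m \<omega>)) + 8 * Y m \<omega> ^ 2 + 3"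
        using inc[of m]
      proof eventually_elim
        case (elim \<omega>)
        define y d where "y = Y m \<omega>" and "d = Y (Suc m) \<omega> - Y m \<omega>"
        have d: "\<bar>d\<bar> \<le> 1" using elim by (simp add: d_def)
        then have d2: "d\<^sup>2 \<le> 1" by (simp add: abs_square_le_1)
        then have d4: "d ^ 4 \<le> 1" using power_le_one[of "d\<^sup>2" 2] by simp
        \<comment> \<open>The cubic term is absorbed by its neighbours: \<open>2 d\<^sup>2 (y - d)\<^sup>2 \<ge> 0\<close>.\<close>
        have "4 * (y * d ^ 3) \<le> 2 * (y\<^sup>2 * d\<^sup>2) + 2 * d ^ 4"
          using zero_le_power2[of "d * (y - d)"] by (simp add: algebra_simps power2_eq_square eval_nat_numeral)
        moreover have "y\<^sup>2 * d\<^sup>2 \<le> y\<^sup>2" using d2 mult_left_mono[of "d\<^sup>2" 1 "y\<^sup>2"] by simp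
        moreover have "(y + d) ^ 4 = y ^ 4 + 4 * (y ^ 3 * d) + 6 * (y\<^sup>2 * d\<^sup>2) + 4 * (y * d ^ 3) + d ^ 4"
          by (simp add: algebra_simps eval_nat_numeral)
        ultimately have "(y + d) ^ 4 \<le> y ^ 4 + 4 * (y ^ 3 * d) + 8 * y\<^sup>2 + 3"
          using d4 by linarith
        then show ?case by (simp add: y_def d_def)
      qed
    qed (intro Bochner_Integration.integrable_add integrable_mult_right int_pow int_inc integrable_const)+
    also have "\<dots> = expectation (\<lambda>\<omega>. Y m \<omega> ^ 4) + 8 * expectation (\<lambda>\<omega>. Y m \<omega> ^ 2) + 3"
      using int_pow int_inc[of m 3] orth3[of m] by (simp add: prob_space)
    also have "\<dots> \<le> 4 * (real m)\<^sup>2 + 8 * real m + 3"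
      using Suc second[of m] by simp
    also have "\<dots> \<le> 4 * (real (Suc m))\<^sup>2" by (simp add: power2_eq_square algebra_simps)
    finally show ?case .
  qed (simp add: Y0)
qed

text \<open>
  The bound is uniform in the starting time \<open>k\<close>: the scaled walk seen from time \<open>k\<close> is again a
  martingale started at \<open>0\<close>, as \<^term>\<open>S k\<close> is part of the past at every later time.
\<close>

lemma skew_random_walk_fourth_moment:
  fixes M :: "'a measure" and S :: "nat \<Rightarrow> 'a \<Rightarrow> int"
  assumes \<alpha>: "0 < \<alpha>" "\<alpha> < 1" and S: "skew_random_walk \<alpha> M S"
  shows "integrable M (\<lambda>\<omega>. real_of_int (S (k + m) \<omega> - S k \<omega>) ^ 4)" (is ?int)
    and "prob_space.expectation M (\<lambda>\<omega>. real_of_int (S (k + m) \<omega> - S k \<omega>) ^ 4)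
       \<le> 4 / min \<alpha> (1 - \<alpha>) ^ 4 * (real m)\<^sup>2" (is ?bound)
proof -
  interpret prob_space M by (rule skew_random_walk_prob_space[OF S])
  note [measurable] = skew_random_walk_measurable[OF S]
  define c where "c = min \<alpha> (1 - \<alpha>)"
  have c: "c > 0" using \<alpha> by (simp add: c_def)
  define Y where "Y m \<omega> = skew_scale \<alpha> (S (k + m) \<omega>) - skew_scale \<alpha> (S k \<omega>)" for m \<omega>
  have Ym: "Y m \<in> borel_measurable M" for m
    unfolding Y_def by measurable
  have inc: "AE \<omega> in M. \<bar>Y (Suc m) \<omega> - Y m \<omega>\<bar> \<le> 1" for m
    using skew_random_walk_unit_steps[OF S, of "k + m"]
    by eventually_elim (use skew_scale_unit_step[OF \<alpha>] in \<open>simp add: Y_def\<close>)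
  have orth: "expectation (\<lambda>\<omega>. Y m \<omega> ^ j * (Y (Suc m) \<omega> - Y m \<omega>)) = 0" for m j
    using skew_scale_martingale[OF S, where k = "k + m"
        and G = "\<lambda>x. (skew_scale \<alpha> (x (k + m)) - skew_scale \<alpha> (x k)) ^ j"]
    by (simp add: Y_def)
  note Y4 = fourth_moment_bounded_increments[of Y, OF Ym _ inc _ orth]
  have int: "integrable M (\<lambda>\<omega>. Y m \<omega> ^ 4)" and ex: "expectation (\<lambda>\<omega>. Y m \<omega> ^ 4) \<le> 4 * (real m)\<^sup>2" for m
    using Y4 orth[of _ 1] by (simp_all add: Y_def)
  have le: "real_of_int (S (k + m) \<omega> - S k \<omega>) ^ 4 \<le> Y m \<omega> ^ 4 / c ^ 4" for \<omega>
  proof -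
    have "(c * \<bar>real_of_int (S (k + m) \<omega> - S k \<omega>)\<bar>) ^ 4 \<le> \<bar>Y m \<omega>\<bar> ^ 4"
      using skew_scale_expanding[of \<alpha>] c unfolding Y_def c_def by (intro power_mono) auto
    then show ?thesis using c by (simp add: power_mult_distrib field_simps)
  qed
  show i: ?int
    by (rule Bochner_Integration.integrable_bound[OF integrable_divide[OF int[of m], of "c ^ 4"]])
      (use le in \<open>auto simp: order_trans[OF _ abs_ge_self]\<close>)
  have "expectation (\<lambda>\<omega>. real_of_int (S (k + m) \<omega> - S k \<omega>) ^ 4) \<le> expectation (\<lambda>\<omega>. Y m \<omega> ^ 4 / c ^ 4)"
    using i int le by (intro integral_mono) auto
  also have "\<dots> \<le> 4 * (real m)\<^sup>2 / c ^ 4"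
    using ex[of m] c by (simp add: divide_right_mono)
  finally show ?bound by (simp add: c_def)
qed

section \<open>Linear interpolation\<close>

definition interp :: "(nat \<Rightarrow> real) \<Rightarrow> real \<Rightarrow> real" where
  "interp f u = f (nat \<lfloor>u\<rfloor>) + (u - real (nat \<lfloor>u\<rfloor>)) * (f (Suc (nat \<lfloor>u\<rfloor>)) - f (nat \<lfloor>u\<rfloor>))"

lemma interp_near_node:
  assumes step: "\<And>j. \<bar>f (Suc j) - f j\<bar> \<le> 1" and "0 \<le> u"
  shows "\<bar>interp f u - f (nat \<lfloor>u\<rfloor>)\<bar> \<le> 1"
proof -
  have "0 \<le> u - real (nat \<lfloor>u\<rfloor>)" "u - real (nat \<lfloor>u\<rfloor>) \<le> 1"
    using \<open>0 \<le> u\<close> by (auto simp: of_nat_nat) linarith+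
  then have "\<bar>u - real (nat \<lfloor>u\<rfloor>)\<bar> * \<bar>f (Suc (nat \<lfloor>u\<rfloor>)) - f (nat \<lfloor>u\<rfloor>)\<bar> \<le> 1 * 1"
    using step by (intro mult_mono) auto
  then show ?thesis by (simp add: interp_def abs_mult)
qed

text \<open>
  Over a gap of length at most \<open>1\<close> the path meets at most two adjacent linear pieces, each of slope
  at most \<open>1\<close> in absolute value.
\<close>

lemma interp_short_increment:
  assumes step: "\<And>j. \<bar>f (Suc j) - f j\<bar> \<le> 1" and "0 \<le> a" "a \<le> b" "b \<le> a + 1"
  shows "\<bar>interp f b - interp f a\<bar> \<le> b - a"
proof -
  define k where "k = nat \<lfloor>a\<rfloor>"
  have a: "real k \<le> a" "a < real k + 1"
    using \<open>0 \<le> a\<close> unfolding k_def by linarith+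
  have scaled: "\<bar>w * (f (Suc j) - f j)\<bar> \<le> w" if "0 \<le> w" for w j
    using mult_left_mono[OF step[of j] that] that by (simp add: abs_mult)
  show ?thesis
  proof (cases "b < real k + 1")
    case True
    then have "nat \<lfloor>b\<rfloor> = k" using a \<open>a \<le> b\<close> by linarith
    then have "interp f b - interp f a = (b - a) * (f (Suc k) - f k)"
      by (simp add: interp_def k_def[symmetric] algebra_simps)
    then show ?thesis using scaled[of "b - a" k] \<open>a \<le> b\<close> by simp
  next
    case False
    then have "nat \<lfloor>b\<rfloor> = Suc k" using a \<open>b \<le> a + 1\<close> by linarith
    then have "interp f b - interp f a
        = (b - real (Suc k)) * (f (Suc (Suc k)) - f (Suc k)) + (real (Suc k) - a) * (f (Suc k) - f k)"
      by (simp add: interp_def k_def[symmetric] algebra_simps)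
    moreover have "\<bar>(b - real (Suc k)) * (f (Suc (Suc k)) - f (Suc k))\<bar> \<le> b - real (Suc k)"
      using False by (intro scaled) auto
    moreover have "\<bar>(real (Suc k) - a) * (f (Suc k) - f k)\<bar> \<le> real (Suc k) - a"
      using a by (intro scaled) auto
    ultimately show ?thesis by linarith
  qed
qed

text \<open>
  Both end points are within \<open>1\<close> of a node value, and \<open>(2 + z)\<^sup>4 \<le> 8 (2\<^sup>4 + z\<^sup>4)\<close> by convexity.
\<close>

lemma interp_increment_pow4:
  assumes step: "\<And>j. \<bar>f (Suc j) - f j\<bar> \<le> 1" and "0 \<le> a" "a \<le> b"
  shows "\<bar>interp f b - interp f a\<bar> ^ 4 \<le> 128 + 8 * (f (nat \<lfloor>b\<rfloor>) - f (nat \<lfloor>a\<rfloor>)) ^ 4"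
proof -
  let ?z = "\<bar>f (nat \<lfloor>b\<rfloor>) - f (nat \<lfloor>a\<rfloor>)\<bar>"
  have "\<bar>interp f b - interp f a\<bar> \<le> 2 + ?z"
    using interp_near_node[of f a, OF step] interp_near_node[of f b, OF step] assms(2,3) by linarith
  then have "\<bar>interp f b - interp f a\<bar> ^ 4 \<le> (2 + ?z) ^ 4"
    by (intro power_mono) auto
  also have "\<dots> \<le> (2 * (4 + ?z\<^sup>2))\<^sup>2"
  proof -
    have "(2 + ?z)\<^sup>2 \<le> 2 * (4 + ?z\<^sup>2)"
      using zero_le_power2[of "2 - ?z"] by (simp add: power2_eq_square algebra_simps)
    then have "((2 + ?z)\<^sup>2)\<^sup>2 \<le> (2 * (4 + ?z\<^sup>2))\<^sup>2" by (intro power_mono) auto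
    then show ?thesis by simp
  qed
  also have "\<dots> \<le> 8 * (16 + (?z\<^sup>2)\<^sup>2)"
    using zero_le_power2[of "4 - ?z\<^sup>2"] by (simp add: power2_eq_square algebra_simps)
  finally show ?thesis by simp
qed

lemma rescaled_walk_eq_interp:
  "rescaled_walk S n t \<omega> = interp (\<lambda>j. real_of_int (S j \<omega>)) (real n * t) / sqrt (real n)"
  by (simp add: rescaled_walk_def interp_def Let_def)

text \<open>
  The constant comes from gaps longer than \<open>1\<close>: there the number \<open>m\<close> of nodes passed is at most
  \<open>b - a + 1 \<le> 2 (b - a)\<close>, so the error \<open>128\<close> is at most \<open>128 (b - a)\<^sup>2\<close>, and \<open>8\<close> times the moment
  bound \<open>4 c\<^sup>-\<^sup>4 m\<^sup>2\<close> is at most \<open>128 c\<^sup>-\<^sup>4 (b - a)\<^sup>2\<close>.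
\<close>

lemma skew_random_walk_interp_fourth_moment:
  fixes M :: "'a measure" and S :: "nat \<Rightarrow> 'a \<Rightarrow> int"
  assumes \<alpha>: "0 < \<alpha>" "\<alpha> < 1" and S: "skew_random_walk \<alpha> M S"
    and ab: "0 \<le> a" "a \<le> b"
  defines "D \<equiv> \<lambda>\<omega>. \<bar>interp (\<lambda>j. real_of_int (S j \<omega>)) b - interp (\<lambda>j. real_of_int (S j \<omega>)) a\<bar> ^ 4"
  shows "integrable M D"
    and "prob_space.expectation M D \<le> (128 + 128 / min \<alpha> (1 - \<alpha>) ^ 4) * (b - a)\<^sup>2"
proof -
  interpret prob_space M by (rule skew_random_walk_prob_space[OF S])
  note [measurable] = skew_random_walk_measurable[OF S]
  define c where "c = min \<alpha> (1 - \<alpha>)"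
  have c: "c > 0" using \<alpha> by (simp add: c_def)
  have [measurable]: "D \<in> borel_measurable M"
    unfolding D_def interp_def by measurable
  have step: "AE \<omega> in M. \<forall>j. \<bar>real_of_int (S (Suc j) \<omega>) - real_of_int (S j \<omega>)\<bar> \<le> 1"
    unfolding AE_all_countable
  proof
    fix j
    show "AE \<omega> in M. \<bar>real_of_int (S (Suc j) \<omega>) - real_of_int (S j \<omega>)\<bar> \<le> 1"
      using skew_random_walk_unit_steps[OF S, of j] by eventually_elim auto
  qed
  define k m where "k = nat \<lfloor>a\<rfloor>" and "m = nat \<lfloor>b\<rfloor> - nat \<lfloor>a\<rfloor>"
  have km: "nat \<lfloor>b\<rfloor> = k + m"
    using ab by (auto simp: k_def m_def nat_mono floor_mono)
  define Z where "Z \<omega> = real_of_int (S (k + m) \<omega> - S k \<omega>) ^ 4" for \<omega>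
  have Z: "integrable M Z" "expectation Z \<le> 4 / c ^ 4 * (real m)\<^sup>2"
    using skew_random_walk_fourth_moment[OF \<alpha> S, of k m] by (simp_all add: Z_def[abs_def] c_def)
  have DZ: "AE \<omega> in M. D \<omega> \<le> 128 + 8 * Z \<omega>"
    using step
  proof eventually_elim
    case (elim \<omega>)
    show ?case
      using interp_increment_pow4[of "\<lambda>j. real_of_int (S j \<omega>)" a b] elim ab
      by (simp add: D_def Z_def km flip: k_def)
  qed
  have D0: "D \<omega> \<ge> 0" and Z0: "Z \<omega> \<ge> 0" for \<omega> by (simp_all add: D_def Z_def)
  show intD: "integrable M D"
  proof (rule Bochner_Integration.integrable_bound)
    show "integrable M (\<lambda>\<omega>. 128 + 8 * Z \<omega>)" using Z(1) by simp
    show "AE \<omega> in M. norm (D \<omega>) \<le> norm (128 + 8 * Z \<omega>)"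
      using DZ by eventually_elim (use D0 Z0 in auto)
  qed simp
  have "expectation D \<le> (128 + 128 / c ^ 4) * (b - a)\<^sup>2"
  proof (cases "b \<le> a + 1")
    case True
    have "AE \<omega> in M. D \<omega> \<le> (b - a)\<^sup>2"
      using step
    proof eventually_elim
      case (elim \<omega>)
      have "D \<omega> \<le> (b - a) ^ 4"
        using interp_short_increment[of "\<lambda>j. real_of_int (S j \<omega>)" a b] elim ab True
        unfolding D_def by (intro power_mono) auto
      also have "\<dots> \<le> (b - a)\<^sup>2" using ab True by (intro power_decreasing) auto
      finally show ?case .
    qed
    then have "expectation D \<le> expectation (\<lambda>_. (b - a)\<^sup>2)"
      using intD by (intro integral_mono_AE) auto
    also have "\<dots> = 1 * (b - a)\<^sup>2" by (simp add: prob_space)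
    also have "\<dots> \<le> (128 + 128 / c ^ 4) * (b - a)\<^sup>2"
      using c by (intro mult_right_mono) (auto simp: add_increasing2)
    finally show ?thesis .
  next
    case False
    have "real m \<le> 2 * (b - a)"
    proof -
      have "real (k + m) \<le> b" "a < real k + 1"
        using ab unfolding km[symmetric] unfolding k_def by linarith+
      then show ?thesis using False by simp
    qed
    then have m: "(real m)\<^sup>2 \<le> (2 * (b - a))\<^sup>2" by (intro power_mono) auto
    have one: "1 \<le> (b - a)\<^sup>2" using False by (simp add: one_le_power)
    have "expectation D \<le> expectation (\<lambda>\<omega>. 128 + 8 * Z \<omega>)"
      using intD Z(1) DZ by (intro integral_mono_AE) auto
    also have "\<dots> = 128 + 8 * expectation Z" using Z(1) by (simp add: prob_space)
    also have "\<dots> \<le> 128 * (b - a)\<^sup>2 + 8 * (4 / c ^ 4 * (2 * (b - a))\<^sup>2)"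
      using one order_trans[OF Z(2) mult_left_mono[OF m]] c by (intro add_mono mult_left_mono) auto
    also have "\<dots> = (128 + 128 / c ^ 4) * (b - a)\<^sup>2"
      by (simp only: power_mult_distrib distrib_right) simp
    finally show ?thesis .
  qed
  then show "expectation D \<le> (128 + 128 / min \<alpha> (1 - \<alpha>) ^ 4) * (b - a)\<^sup>2"
    by (simp add: c_def)
qed

section \<open>Moment bound for the rescaled walk\<close>

theorem theorem1p1:
  fixes \<alpha> :: real
  assumes "0 < \<alpha>" and "\<alpha> < 1"
  shows "\<exists>C>0. \<forall>(M :: 'a measure) (S :: nat \<Rightarrow> 'a \<Rightarrow> int). skew_random_walk \<alpha> M S \<longrightarrow>
           (\<forall>n\<ge>1. \<forall>s>0. \<forall>t>0.
              integrable M (\<lambda>\<omega>. \<bar>rescaled_walk S n t \<omega> - rescaled_walk S n s \<omega>\<bar> ^ 4) \<and>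
              prob_space.expectation M (\<lambda>\<omega>. \<bar>rescaled_walk S n t \<omega> - rescaled_walk S n s \<omega>\<bar> ^ 4)
                \<le> C * \<bar>s - t\<bar> ^ 2)"
proof -
  define C where "C = 128 + 128 / min \<alpha> (1 - \<alpha>) ^ 4"
  have C: "C > 0" using assms by (auto simp: C_def intro!: add_pos_nonneg)
  have ordered: "integrable M (\<lambda>\<omega>. \<bar>rescaled_walk S n t \<omega> - rescaled_walk S n s \<omega>\<bar> ^ 4) \<and>
      prob_space.expectation M (\<lambda>\<omega>. \<bar>rescaled_walk S n t \<omega> - rescaled_walk S n s \<omega>\<bar> ^ 4)
        \<le> C * \<bar>s - t\<bar> ^ 2"
    if S: "skew_random_walk \<alpha> M S" and n: "1 \<le> n" and st: "0 < s" "s \<le> t"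
    for M :: "'a measure" and S :: "nat \<Rightarrow> 'a \<Rightarrow> int" and n s t
  proof -
    define D where "D \<omega> = \<bar>interp (\<lambda>j. real_of_int (S j \<omega>)) (real n * t)
      - interp (\<lambda>j. real_of_int (S j \<omega>)) (real n * s)\<bar> ^ 4" for \<omega>
    have "0 \<le> real n * s" "real n * s \<le> real n * t"
      using st by (auto intro!: mult_left_mono)
    note D = skew_random_walk_interp_fourth_moment[OF assms S this, folded D_def[abs_def] C_def]
    have "sqrt (real n) ^ 4 = (real n)\<^sup>2"
      using power_mult[of "sqrt (real n)" 2 2] by simp
    then have eq: "\<bar>rescaled_walk S n t \<omega> - rescaled_walk S n s \<omega>\<bar> ^ 4 = D \<omega> / (real n)\<^sup>2" for \<omega>
      by (simp add: rescaled_walk_eq_interp D_def power_divide abs_divide flip: diff_divide_distrib)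
    have "prob_space.expectation M D / (real n)\<^sup>2 \<le> C * (real n * t - real n * s)\<^sup>2 / (real n)\<^sup>2"
      using D(2) by (intro divide_right_mono) auto
    also have "\<dots> = C * \<bar>s - t\<bar> ^ 2"
      using n by (simp add: power2_eq_square field_simps)
    finally show ?thesis using D(1) by (simp add: eq)
  qed
  show ?thesis
  proof (intro exI[of _ C] conjI C allI impI)
    fix M :: "'a measure" and S :: "nat \<Rightarrow> 'a \<Rightarrow> int" and n :: nat and s t :: real
    assume S: "skew_random_walk \<alpha> M S" and n: "1 \<le> n" and st: "0 < s" "0 < t"
    show "integrable M (\<lambda>\<omega>. \<bar>rescaled_walk S n t \<omega> - rescaled_walk S n s \<omega>\<bar> ^ 4)"
      using ordered[OF S n, of s t] ordered[OF S n, of t s] st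
      by (cases "s \<le> t") (auto simp: abs_minus_commute)
    show "prob_space.expectation M (\<lambda>\<omega>. \<bar>rescaled_walk S n t \<omega> - rescaled_walk S n s \<omega>\<bar> ^ 4)
        \<le> C * \<bar>s - t\<bar> ^ 2"
      using ordered[OF S n, of s t] ordered[OF S n, of t s] st
      by (cases "s \<le> t") (auto simp: abs_minus_commute)
  qed
qed

end
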